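(* Let $(A,\cdot,\circ,P,Q)$ be a relative PCA algebra and $(A,\cdot,[-,-],P)$ be its associated relative Poisson algebra. Consider the relative Poisson algebra on $A\oplus A^{*}$ with linear map $P+Q^{*}$ and operations $$(x+a^{*})\cdot(y+b^{*})=x\cdot y-\mathcal{L}^{*}_{\cdot}(x)b^{*}-\mathcal{L}^{*}_{\cdot}(y)a^{*},\qquad [x+a^{*},y+b^{*}]=[x,y]-\mathcal{L}^{*}_{\circ}(x)b^{*}+\mathcal{L}^{*}_{\circ}(y)a^{*}.$$ Then the nondegenerate symmetric bilinear form $\mathcal{B}_{d}$ on $A\oplus A^{*}$ defined by $$\mathcal{B}_{d}(x+a^{*},y+b^{*})=\langle x,b^{*}\rangle+\langle a^{*},y\rangle,\quad\forall x,y\in A,\ a^{*},b^{*}\in A^{*},$$ is invariant on the commutative associative algebra $(A\oplus A^*,\cdot)$ and is a commutative $2$-cocycle on the Lie algebra $(A\oplus A^*,[-,-])$; that is, $\mathcal{B}_{d}$ is an invariant-c2c form on the relative Poisson algebra $(A\oplus A^{*},\cdot,[-,-],P+Q^{*})$.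
   Context: All vector spaces are finite-dimensional over an algebraically closed field $\mathbb K$ of characteristic zero. For a binary operation $\diamond$ on $A$, $\mathcal{L}_{\diamond}(x)y=x\diamond y$. For $f:A\rightarrow \mathrm{End}_{\mathbb K}(V)$, $f^{*}:A\rightarrow\mathrm{End}_{\mathbb K}(V^{*})$ is defined by $\langle f^{*}(x)u^{*},v\rangle=-\langle u^{*},f(x)v\rangle$. For a linear map $Q:A\to A$, $Q^{*}$ is the usual transpose (no sign). A relative Poisson algebra is a quadruple $(A,\cdot,[-,-],P)$ where $(A,\cdot)$ is a commutative associative algebra, $(A,[-,-])$ is a Lie algebra, $P$ is a derivation of both $(A,\cdot)$ and $(A,[-,-])$, and $[z,x\cdot y]=[z,x]\cdot y+x\cdot[z,y]+x\cdot y\cdot P(z)$ for all $x,y,z\in A$. An anti-pre-Lie algebra is a pair $(A,\circ)$ with a binary operation $\circ$ such that, with $[x,y]=x\circ y-y\circ x$, one has $x\circ(y\circ z)-y\circ(x\circ z)=[y,x]\circ z$ and $[x,y]\circ z+[y,z]\circ x+[z,x]\circ y=0$ for all $x,y,z$. Then $(A,[-,-])$ is a Lie algebra, the sub-adjacent Lie algebra of $(A,\circ)$. A relative PCA algebra is a tuple $(A,\cdot,\circ,P,Q)$ where $(A,\cdot)$ is a commutative associative algebra, $(A,\circ)$ is an anti-pre-Lie algebra with sub-adjacent Lie algebra $(A,[-,-])$, $P,Q:A\to A$ are linear maps, $(A,\cdot,[-,-],P)$ is a relative Poisson algebra (the associated relative Poisson algebra), and for all $x,y,z\in A$: $x\cdot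 Q(y)-P(x)\cdot y-Q(x\cdot y)=0$; $x\circ Q(y)-P(x)\circ y-Q(x\circ y)=0$; $x\cdot(y\circ z)-y\circ(x\cdot z)+[x,y]\cdot z-x\cdot P(y)\cdot z=0$; $(x\cdot y)\circ z-y\circ(x\cdot z)-x\circ(y\cdot z)+Q(x\cdot y\cdot z)=0$. It is known that for a relative PCA algebra the operations on $A\oplus A^*$ in the claim do define a relative Poisson algebra with linear map $P+Q^*$. A bilinear form $\mathcal B$ on a commutative associative algebra is invariant if $\mathcal B(x\cdot y,z)=\mathcal B(x,y\cdot z)$ for all $x,y,z$. A symmetric bilinear form $\mathcal B$ on a Lie algebra is a commutative $2$-cocycle if $\mathcal{B}([x,y],z)+\mathcal{B}([y,z],x)+\mathcal{B}([z,x],y)=0$ for all $x,y,z$. An invariant-c2c form on a relative Poisson algebra $(A,\cdot,[-,-],P)$ is a nondegenerate symmetric bilinear form on $A$ that is invariant on $(A,\cdot)$ and a commutative $2$-cocycle on $(A,[-,-])$. *)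

theory Defs
  imports
    "HOL-Computational_Algebra.Polynomial"
    "HOL-Library.Function_Algebras"
    "HOL-Analysis.Product_Vector"
begin

section \<open>Finite-dimensional spaces and maps between them\<close>

text \<open>
  Spaces are subspaces \<open>V\<close> of an ambient vector space given by a type and a scalar
  multiplication. Explicit carriers are needed because the dual space is a proper subset of a
  function type, so that \<open>A \<oplus> A\<^sup>*\<close> is not a whole type. Only the values of operations and
  maps on the carrier matter.
\<close>

locale fin_dim_space = vector_space scale
  for scale :: "'k::{alg_closed_field,field_char_0} \<Rightarrow> 'v::ab_group_add \<Rightarrow> 'v" +
  fixes V :: "'v set"
  assumes subspace_carrier: "subspace V"
    and finite_spanning: "\<exists>B. finite B \<and> span B = V"

definition linear_on ::
  "('k \<Rightarrow> 'v::ab_group_add \<Rightarrow> 'v) \<Rightarrow> ('k \<Rightarrow> 'w::ab_group_add \<Rightarrow> 'w) \<Rightarrow> 'v set \<Rightarrow> 'w set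
    \<Rightarrow> ('v \<Rightarrow> 'w) \<Rightarrow> bool" where
  "linear_on s1 s2 V W f \<longleftrightarrow>
     (\<forall>x\<in>V. f x \<in> W) \<and>
     (\<forall>x\<in>V. \<forall>y\<in>V. f (x + y) = f x + f y) \<and>
     (\<forall>c. \<forall>x\<in>V. f (s1 c x) = s2 c (f x))"

definition bilinear_on ::
  "('k \<Rightarrow> 'v::ab_group_add \<Rightarrow> 'v) \<Rightarrow> ('k \<Rightarrow> 'w::ab_group_add \<Rightarrow> 'w) \<Rightarrow> 'v set \<Rightarrow> 'w set
    \<Rightarrow> ('v \<Rightarrow> 'v \<Rightarrow> 'w) \<Rightarrow> bool" where
  "bilinear_on s1 s2 V W b \<longleftrightarrow>
     (\<forall>x\<in>V. linear_on s1 s2 V W (\<lambda>y. b x y)) \<and>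
     (\<forall>y\<in>V. linear_on s1 s2 V W (\<lambda>x. b x y))"

section \<open>Algebraic structures\<close>

locale comm_assoc_algebra = fin_dim_space scale V
  for scale :: "'k::{alg_closed_field,field_char_0} \<Rightarrow> 'v::ab_group_add \<Rightarrow> 'v"
    and V :: "'v set" +
  fixes mul :: "'v \<Rightarrow> 'v \<Rightarrow> 'v" (infixl "\<cdot>" 70)
  assumes mul_bilinear: "bilinear_on scale scale V V (\<cdot>)"
    and mul_commute: "\<lbrakk>x \<in> V; y \<in> V\<rbrakk> \<Longrightarrow> x \<cdot> y = y \<cdot> x"
    and mul_assoc: "\<lbrakk>x \<in> V; y \<in> V; z \<in> V\<rbrakk> \<Longrightarrow> (x \<cdot> y) \<cdot> z = x \<cdot> (y \<cdot> z)"

locale lie_algebra = fin_dim_space scale V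
  for scale :: "'k::{alg_closed_field,field_char_0} \<Rightarrow> 'v::ab_group_add \<Rightarrow> 'v"
    and V :: "'v set" +
  fixes br :: "'v \<Rightarrow> 'v \<Rightarrow> 'v"
  assumes br_bilinear: "bilinear_on scale scale V V br"
    and br_self: "x \<in> V \<Longrightarrow> br x x = 0"
    and jacobi: "\<lbrakk>x \<in> V; y \<in> V; z \<in> V\<rbrakk> \<Longrightarrow>
      br x (br y z) + br y (br z x) + br z (br x y) = 0"

definition derivation_on ::
  "('k \<Rightarrow> 'v::ab_group_add \<Rightarrow> 'v) \<Rightarrow> 'v set \<Rightarrow> ('v \<Rightarrow> 'v \<Rightarrow> 'v) \<Rightarrow> ('v \<Rightarrow> 'v) \<Rightarrow> bool" where
  "derivation_on s V m D \<longleftrightarrow>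
     linear_on s s V V D \<and>
     (\<forall>x\<in>V. \<forall>y\<in>V. D (m x y) = m (D x) y + m x (D y))"

locale relative_poisson_algebra =
  comm_assoc_algebra scale V mul + lie_algebra scale V br
  for scale :: "'k::{alg_closed_field,field_char_0} \<Rightarrow> 'v::ab_group_add \<Rightarrow> 'v"
    and V :: "'v set"
    and mul :: "'v \<Rightarrow> 'v \<Rightarrow> 'v" (infixl "\<cdot>" 70)
    and br :: "'v \<Rightarrow> 'v \<Rightarrow> 'v" +
  fixes P :: "'v \<Rightarrow> 'v"
  assumes derivation_mul: "derivation_on scale V (\<cdot>) P"
    and derivation_br: "derivation_on scale V br P"
    and relative_leibniz: "\<lbrakk>x \<in> V; y \<in> V; z \<in> V\<rbrakk> \<Longrightarrow>
      br z (x \<cdot> y) = br z x \<cdot> y + x \<cdot> br z y + x \<cdot> y \<cdot> P z"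

definition commutator :: "('v::ab_group_add \<Rightarrow> 'v \<Rightarrow> 'v) \<Rightarrow> 'v \<Rightarrow> 'v \<Rightarrow> 'v" where
  "commutator m x y = m x y - m y x"

locale anti_pre_lie_algebra = fin_dim_space scale V
  for scale :: "'k::{alg_closed_field,field_char_0} \<Rightarrow> 'v::ab_group_add \<Rightarrow> 'v"
    and V :: "'v set" +
  fixes circ :: "'v \<Rightarrow> 'v \<Rightarrow> 'v" (infixl "\<circ>\<^sub>A" 70)
  assumes circ_bilinear: "bilinear_on scale scale V V (\<circ>\<^sub>A)"
    and anti_pre_lie: "\<lbrakk>x \<in> V; y \<in> V; z \<in> V\<rbrakk> \<Longrightarrow>
      x \<circ>\<^sub>A (y \<circ>\<^sub>A z) - y \<circ>\<^sub>A (x \<circ>\<^sub>A z) = commutator (\<circ>\<^sub>A) y x \<circ>\<^sub>A z"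
    and anti_pre_lie_cyclic: "\<lbrakk>x \<in> V; y \<in> V; z \<in> V\<rbrakk> \<Longrightarrow>
      commutator (\<circ>\<^sub>A) x y \<circ>\<^sub>A z + commutator (\<circ>\<^sub>A) y z \<circ>\<^sub>A x + commutator (\<circ>\<^sub>A) z x \<circ>\<^sub>A y = 0"

locale relative_PCA_algebra =
  anti_pre_lie_algebra scale V circ +
  relative_poisson_algebra scale V mul "commutator circ" P
  for scale :: "'k::{alg_closed_field,field_char_0} \<Rightarrow> 'v::ab_group_add \<Rightarrow> 'v"
    and V :: "'v set"
    and mul :: "'v \<Rightarrow> 'v \<Rightarrow> 'v" (infixl "\<cdot>" 70)
    and circ :: "'v \<Rightarrow> 'v \<Rightarrow> 'v" (infixl "\<circ>\<^sub>A" 70)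
    and P :: "'v \<Rightarrow> 'v" +
  fixes Q :: "'v \<Rightarrow> 'v"
  assumes Q_linear: "linear_on scale scale V V Q"
    and Q_mul: "\<lbrakk>x \<in> V; y \<in> V\<rbrakk> \<Longrightarrow> x \<cdot> Q y - P x \<cdot> y - Q (x \<cdot> y) = 0"
    and Q_circ: "\<lbrakk>x \<in> V; y \<in> V\<rbrakk> \<Longrightarrow> x \<circ>\<^sub>A Q y - P x \<circ>\<^sub>A y - Q (x \<circ>\<^sub>A y) = 0"
    and mul_circ: "\<lbrakk>x \<in> V; y \<in> V; z \<in> V\<rbrakk> \<Longrightarrow>
      x \<cdot> (y \<circ>\<^sub>A z) - y \<circ>\<^sub>A (x \<cdot> z) + commutator (\<circ>\<^sub>A) x y \<cdot> z - x \<cdot> P y \<cdot> z = 0"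
    and circ_mul: "\<lbrakk>x \<in> V; y \<in> V; z \<in> V\<rbrakk> \<Longrightarrow>
      (x \<cdot> y) \<circ>\<^sub>A z - y \<circ>\<^sub>A (x \<cdot> z) - x \<circ>\<^sub>A (y \<cdot> z) + Q (x \<cdot> y \<cdot> z) = 0"

section \<open>Bilinear forms\<close>

definition symmetric_form :: "'v set \<Rightarrow> ('v \<Rightarrow> 'v \<Rightarrow> 'k) \<Rightarrow> bool" where
  "symmetric_form V B \<longleftrightarrow> (\<forall>x\<in>V. \<forall>y\<in>V. B x y = B y x)"

text \<open>Triviality of one radical suffices here, as the forms below are symmetric and the spaces
  finite-dimensional.\<close>

definition nondegenerate_form :: "'v::zero set \<Rightarrow> ('v \<Rightarrow> 'v \<Rightarrow> 'k::zero) \<Rightarrow> bool" where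
  "nondegenerate_form V B \<longleftrightarrow> (\<forall>x\<in>V. (\<forall>y\<in>V. B x y = 0) \<longrightarrow> x = 0)"

definition invariant_form :: "'v set \<Rightarrow> ('v \<Rightarrow> 'v \<Rightarrow> 'v) \<Rightarrow> ('v \<Rightarrow> 'v \<Rightarrow> 'k) \<Rightarrow> bool" where
  "invariant_form V m B \<longleftrightarrow> (\<forall>x\<in>V. \<forall>y\<in>V. \<forall>z\<in>V. B (m x y) z = B x (m y z))"

definition commutative_2_cocycle ::
  "'v set \<Rightarrow> ('v \<Rightarrow> 'v \<Rightarrow> 'v) \<Rightarrow> ('v \<Rightarrow> 'v \<Rightarrow> 'k::ab_group_add) \<Rightarrow> bool" where
  "commutative_2_cocycle V br B \<longleftrightarrow>
     symmetric_form V B \<and>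
     (\<forall>x\<in>V. \<forall>y\<in>V. \<forall>z\<in>V. B (br x y) z + B (br y z) x + B (br z x) y = 0)"

locale invariant_c2c_form = relative_poisson_algebra scale V mul br P
  for scale :: "'k::{alg_closed_field,field_char_0} \<Rightarrow> 'v::ab_group_add \<Rightarrow> 'v"
    and V :: "'v set"
    and mul :: "'v \<Rightarrow> 'v \<Rightarrow> 'v"
    and br :: "'v \<Rightarrow> 'v \<Rightarrow> 'v"
    and P :: "'v \<Rightarrow> 'v" +
  fixes B :: "'v \<Rightarrow> 'v \<Rightarrow> 'k"
  assumes form_bilinear: "bilinear_on scale (*) V UNIV B"
    and form_symmetric: "symmetric_form V B"
    and form_nondegenerate: "nondegenerate_form V B"
    and form_invariant: "invariant_form V mul B"
    and form_cocycle: "commutative_2_cocycle V br B"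

section \<open>The dual space and the operations on the double\<close>

text \<open>A linear functional on \<open>V\<close> is represented by its extension by zero to the ambient type,
  so that elements of the dual are equal iff they agree on \<open>V\<close>.\<close>

definition dual_space :: "('k::field \<Rightarrow> 'v::ab_group_add \<Rightarrow> 'v) \<Rightarrow> 'v set \<Rightarrow> ('v \<Rightarrow> 'k) set" where
  "dual_space s V = {u. linear_on s (*) V UNIV u \<and> (\<forall>v. v \<notin> V \<longrightarrow> u v = 0)}"

definition fun_scale :: "'k::times \<Rightarrow> ('v \<Rightarrow> 'k) \<Rightarrow> 'v \<Rightarrow> 'k" where
  "fun_scale c u = (\<lambda>v. c * u v)"

text \<open>\<open>f\<^sup>*\<close> carries a sign, the transpose of a single linear map does not. For an operation
  \<open>m\<close>, the map \<open>\<L>\<^sub>m\<close> is \<open>m\<close> itself (curried), so \<open>\<L>\<^sub>m\<^sup>*\<close> is \<open>dual_map V m\<close>.\<close>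

definition dual_map ::
  "'v set \<Rightarrow> ('v \<Rightarrow> 'v \<Rightarrow> 'v) \<Rightarrow> 'v \<Rightarrow> ('v \<Rightarrow> 'k::ab_group_add) \<Rightarrow> 'v \<Rightarrow> 'k" where
  "dual_map V f x u = (\<lambda>v. if v \<in> V then - u (f x v) else 0)"

definition transpose_map :: "'v set \<Rightarrow> ('v \<Rightarrow> 'v) \<Rightarrow> ('v \<Rightarrow> 'k::zero) \<Rightarrow> 'v \<Rightarrow> 'k" where
  "transpose_map V Q u = (\<lambda>v. if v \<in> V then u (Q v) else 0)"

definition double_space ::
  "('k::field \<Rightarrow> 'v::ab_group_add \<Rightarrow> 'v) \<Rightarrow> 'v set \<Rightarrow> ('v \<times> ('v \<Rightarrow> 'k)) set" where
  "double_space s V = V \<times> dual_space s V"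

definition double_scale ::
  "('k::field \<Rightarrow> 'v::ab_group_add \<Rightarrow> 'v) \<Rightarrow> 'k \<Rightarrow> 'v \<times> ('v \<Rightarrow> 'k) \<Rightarrow> 'v \<times> ('v \<Rightarrow> 'k)" where
  "double_scale s = module_prod.scale s fun_scale"

definition double_mul ::
  "'v set \<Rightarrow> ('v \<Rightarrow> 'v \<Rightarrow> 'v) \<Rightarrow> 'v \<times> ('v \<Rightarrow> 'k::field) \<Rightarrow> 'v \<times> ('v \<Rightarrow> 'k) \<Rightarrow> 'v \<times> ('v \<Rightarrow> 'k)" where
  "double_mul V mul = (\<lambda>(x, a) (y, b). (mul x y, - dual_map V mul x b - dual_map V mul y a))"

definition double_bracket ::
  "'v::ab_group_add set \<Rightarrow> ('v \<Rightarrow> 'v \<Rightarrow> 'v) \<Rightarrow> 'v \<times> ('v \<Rightarrow> 'k::field) \<Rightarrow> 'v \<times> ('v \<Rightarrow> 'k)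
    \<Rightarrow> 'v \<times> ('v \<Rightarrow> 'k)" where
  "double_bracket V circ = (\<lambda>(x, a) (y, b).
     (commutator circ x y, - dual_map V circ x b + dual_map V circ y a))"

definition double_map ::
  "'v set \<Rightarrow> ('v \<Rightarrow> 'v) \<Rightarrow> ('v \<Rightarrow> 'v) \<Rightarrow> 'v \<times> ('v \<Rightarrow> 'k::zero) \<Rightarrow> 'v \<times> ('v \<Rightarrow> 'k)" where
  "double_map V P Q = map_prod P (transpose_map V Q)"

definition double_form :: "'v \<times> ('v \<Rightarrow> 'k::plus) \<Rightarrow> 'v \<times> ('v \<Rightarrow> 'k) \<Rightarrow> 'k" where
  "double_form = (\<lambda>(x, a) (y, b). b x + a y)"

end

theory Submission
  imports Defs
begin

text \<open>
  Writing an element of the double as \<open>(x, a)\<close> and evaluating its functional at \<open>v \<in> A\<close>, each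
  axiom of the double splits into the same axiom on \<open>A\<close> and an identity of functionals. In
  the latter, the terms involving one fixed functional form a single axiom of \<open>A\<close>: the
  anti-pre-Lie identity gives the Jacobi identity, the two compatibilities of \<open>Q\<close> with \<open>P\<close> give
  the derivations, and the two remaining axioms relating \<open>\<cdot>\<close> and \<open>\<circ>\<close> give the relative Leibniz
  rule. Invariance and the cocycle condition for the pairing need only that the product is
  commutative and the bracket is the commutator.
\<close>

section \<open>Linear and bilinear maps on a carrier\<close>

context fin_dim_space
begin

lemma carrier_closed:
  "0 \<in> V"
  "x \<in> V \<Longrightarrow> y \<in> V \<Longrightarrow> x + y \<in> V"
  "x \<in> V \<Longrightarrow> y \<in> V \<Longrightarrow> x - y \<in> V"
  "x \<in> V \<Longrightarrow> - x \<in> V"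
  "x \<in> V \<Longrightarrow> scale c x \<in> V"
  using subspace_carrier
  by (simp_all add: subspace_0 subspace_add subspace_diff subspace_neg subspace_scale)

text \<open>A maximal independent subset of the carrier spans it and is no larger than the given
  finite spanning set. The ambient space may be infinite-dimensional, so the basis is taken inside
  \<open>V\<close>.\<close>

lemma finite_basis:
  obtains B where "finite B" "independent B" "B \<subseteq> V" "span B = V"
proof -
  obtain B where B: "B \<subseteq> V" "independent B" "V \<subseteq> span B"
    using maximal_independent_subset by metis
  obtain S where "finite S" "span S = V"
    using finite_spanning by blast
  then have "finite B"
    using independent_span_bound B by blast
  then show ?thesis
    using that B span_minimal subspace_carrier by (metis subset_antisym)
qed

lemma linear_on_minus:
  assumes f: "linear_on scale s V W f" and s: "vector_space s" and x: "x \<in> V"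
  shows "f (- x) = - f x"
proof -
  interpret W: vector_space s by (rule s)
  have "f (- x) = f (scale (- 1) x)" by simp
  also have "\<dots> = s (- 1) (f x)" using f x unfolding linear_on_def by blast
  finally show ?thesis by simp
qed

lemma linear_on_diff:
  assumes f: "linear_on scale s V W f" and s: "vector_space s" and x: "x \<in> V" and y: "y \<in> V"
  shows "f (x - y) = f x - f y"
proof -
  have "f (x + - y) = f x + f (- y)"
    using f x y carrier_closed(4) unfolding linear_on_def by blast
  then show ?thesis
    using linear_on_minus[OF f s y] by simp
qed

lemma bilinear_on_simps:
  assumes "bilinear_on scale scale V V m" "x \<in> V" "y \<in> V"
  shows "m x y \<in> V"
    and "z \<in> V \<Longrightarrow> m (x + y) z = m x z + m y z"
    and "z \<in> V \<Longrightarrow> m z (x + y) = m z x + m z y"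
    and "z \<in> V \<Longrightarrow> m (x - y) z = m x z - m y z"
    and "z \<in> V \<Longrightarrow> m z (x - y) = m z x - m z y"
    and "m (scale c x) y = scale c (m x y)"
    and "m x (scale c y) = scale c (m x y)"
proof -
  have l: "linear_on scale scale V V (m u)" and r: "linear_on scale scale V V (\<lambda>v. m v u)"
    if "u \<in> V" for u
    using that assms(1) unfolding bilinear_on_def by auto
  have s: "vector_space scale" by unfold_locales
  show "m x y \<in> V"
    "z \<in> V \<Longrightarrow> m (x + y) z = m x z + m y z"
    "z \<in> V \<Longrightarrow> m z (x + y) = m z x + m z y"
    "m (scale c x) y = scale c (m x y)"
    "m x (scale c y) = scale c (m x y)"
    using l r assms(2,3) unfolding linear_on_def by blast+
  show "m (x - y) z = m x z - m y z" if "z \<in> V"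
    using linear_on_diff[OF r[OF that] s] assms(2,3) .
  show "m z (x - y) = m z x - m z y" if "z \<in> V"
    using linear_on_diff[OF l[OF that] s] assms(2,3) .
qed

end

section \<open>The dual space\<close>

lemma vector_space_fun_scale: "vector_space (fun_scale :: 'k::field \<Rightarrow> ('v \<Rightarrow> 'k) \<Rightarrow> 'v \<Rightarrow> 'k)"
  by unfold_locales (auto simp: fun_scale_def algebra_simps)

lemma sum_fun_apply: "(\<Sum>i\<in>I. f i) x = (\<Sum>i\<in>I. f i x)" for f :: "'i \<Rightarrow> 'a \<Rightarrow> 'b::comm_monoid_add"
  by (induction I rule: infinite_finite_induct) auto

context fin_dim_space
begin

lemma dual_spaceD:
  assumes "u \<in> dual_space scale V"
  shows "x \<in> V \<Longrightarrow> y \<in> V \<Longrightarrow> u (x + y) = u x + u y"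
    and "x \<in> V \<Longrightarrow> y \<in> V \<Longrightarrow> u (x - y) = u x - u y"
    and "x \<in> V \<Longrightarrow> u (- x) = - u x"
    and "x \<in> V \<Longrightarrow> u (scale c x) = c * u x"
    and "u 0 = 0"
    and "x \<notin> V \<Longrightarrow> u x = 0"
proof -
  have u: "linear_on scale (*) V UNIV u" and 0: "\<forall>v. v \<notin> V \<longrightarrow> u v = 0"
    using assms unfolding dual_space_def by auto
  have s: "vector_space ((*) :: 'k \<Rightarrow> 'k \<Rightarrow> 'k)"
    by unfold_locales (auto simp: algebra_simps)
  show "x \<in> V \<Longrightarrow> y \<in> V \<Longrightarrow> u (x + y) = u x + u y" "x \<in> V \<Longrightarrow> u (scale c x) = c * u x"
    using u unfolding linear_on_def by blast+
  show "x \<in> V \<Longrightarrow> y \<in> V \<Longrightarrow> u (x - y) = u x - u y"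
    by (rule linear_on_diff[OF u s])
  show "x \<in> V \<Longrightarrow> u (- x) = - u x"
    by (rule linear_on_minus[OF u s])
  show "u 0 = 0"
    using linear_on_diff[OF u s carrier_closed(1,1)] by simp
  show "x \<notin> V \<Longrightarrow> u x = 0" using 0 by blast
qed

lemma dual_spaceI:
  assumes "\<And>x y. x \<in> V \<Longrightarrow> y \<in> V \<Longrightarrow> u (x + y) = u x + u y"
    and "\<And>c x. x \<in> V \<Longrightarrow> u (scale c x) = c * u x"
    and "\<And>x. x \<notin> V \<Longrightarrow> u x = 0"
  shows "u \<in> dual_space scale V"
  using assms unfolding dual_space_def linear_on_def by auto

text \<open>\<open>representation B\<close> is linear on \<open>span B\<close>, which contains the
  carrier. The cut-off outside \<open>V\<close> matches the extension by zero in
  \<open>dual_space\<close>.\<close>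

lemma coordinate_in_dual_space:
  assumes "independent B" "V \<subseteq> span B"
  shows "(\<lambda>v. if v \<in> V then representation B v b else 0) \<in> dual_space scale V"
proof (rule dual_spaceI)
  fix x y c assume x: "x \<in> V"
  show "(if scale c x \<in> V then representation B (scale c x) b else 0)
    = c * (if x \<in> V then representation B x b else 0)"
    using x assms carrier_closed(5)[OF x] by (auto simp: representation_scale subset_iff)
  assume y: "y \<in> V"
  show "(if x + y \<in> V then representation B (x + y) b else 0)
    = (if x \<in> V then representation B x b else 0) + (if y \<in> V then representation B y b else 0)"
    using x y assms carrier_closed(2)[OF x y] by (auto simp: representation_add subset_iff)
qed simp

text \<open>The coordinates of \<open>x\<close> in a finite basis are values of functionals from the
  dual, so they all vanish, and with them the basis expansion of \<open>x\<close>. This is the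
  vector half of nondegeneracy.\<close>

lemma dual_space_separates:
  assumes "x \<in> V" "\<And>u. u \<in> dual_space scale V \<Longrightarrow> u x = 0"
  shows "x = 0"
proof -
  obtain B where B: "finite B" "independent B" "span B = V"
    using finite_basis by metis
  have "representation B x b = 0" for b
    using assms(2)[OF coordinate_in_dual_space[OF B(2), of b]] assms(1) B(3) by simp
  then show ?thesis
    using sum_representation_eq[OF B(2), of x B] assms(1) B by simp
qed

lemma subspace_dual_space: "module.subspace fun_scale (dual_space scale V)"
proof -
  interpret F: vector_space "fun_scale :: 'k \<Rightarrow> ('v \<Rightarrow> 'k) \<Rightarrow> 'v \<Rightarrow> 'k"
    by (rule vector_space_fun_scale)
  show ?thesis
    by (rule F.subspaceI; rule dual_spaceI)
      (auto simp: dual_spaceD fun_scale_def algebra_simps)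
qed

text \<open>The dual basis of a finite basis spans: a functional is the combination of the
  coordinate functionals whose coefficients are its own values on the basis.\<close>

lemma fin_dim_dual_space: "fin_dim_space fun_scale (dual_space scale V)"
proof -
  interpret F: vector_space "fun_scale :: 'k \<Rightarrow> ('v \<Rightarrow> 'k) \<Rightarrow> 'v \<Rightarrow> 'k"
    by (rule vector_space_fun_scale)
  obtain B where B: "finite B" "independent B" "B \<subseteq> V" "span B = V"
    using finite_basis .
  define e where "e b v = (if v \<in> V then representation B v b else 0)" for b v
  have e: "e b \<in> dual_space scale V" for b
    unfolding e_def using coordinate_in_dual_space B by simp
  have "u \<in> F.span (e ` B)" if u: "u \<in> dual_space scale V" for u
  proof -
    \<comment> \<open>Since \<open>u\<close> is linear only on the carrier, the induction has to
      keep every partial sum in \<open>V\<close>; hence the restriction to subsets of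
      \<open>B\<close>.\<close>
    have additive: "u (\<Sum>b\<in>C. scale (c b) b) = (\<Sum>b\<in>C. c b * u b)" if "C \<subseteq> B" for C c
      using finite_subset[OF that B(1)] that
    proof (induction C rule: finite_induct)
      case (insert b C)
      have "(\<Sum>b\<in>C. scale (c b) b) \<in> V"
        using insert.prems B(3) by (intro subspace_sum[OF subspace_carrier]) (auto intro: carrier_closed)
      then show ?case
        using insert B(3) by (simp add: dual_spaceD[OF u] carrier_closed subset_iff)
    qed (simp add: dual_spaceD[OF u])
    \<comment> \<open>On the carrier this is the basis expansion of \<open>v\<close> under
      \<open>u\<close>; elsewhere both sides are zero by the extension convention.\<close>
    have "u = (\<Sum>b\<in>B. fun_scale (u b) (e b))"
    proof
      fix v
      show "u v = (\<Sum>b\<in>B. fun_scale (u b) (e b)) v"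
      proof (cases "v \<in> V")
        case True
        then have "v = (\<Sum>b\<in>B. scale (representation B v b) b)"
          using sum_representation_eq[OF B(2), of v B] B by simp
        then have "u v = (\<Sum>b\<in>B. representation B v b * u b)"
          using additive[of B "representation B v"] by simp
        then show ?thesis
          using True by (simp add: sum_fun_apply fun_scale_def e_def mult.commute)
      qed (simp add: sum_fun_apply fun_scale_def e_def dual_spaceD[OF u])
    qed
    also have "\<dots> \<in> F.span (e ` B)"
      by (intro F.span_sum F.span_scale F.span_base) auto
    finally show ?thesis .
  qed
  then have "F.span (e ` B) = dual_space scale V"
    using F.span_minimal[OF _ subspace_dual_space, of "e ` B"] e by auto
  then show ?thesis
    using B(1) by unfold_locales (auto simp: subspace_dual_space)
qed

text \<open>Bilinearity of the product and the bracket on the double comes down to these facts in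
  the functional component. Each is checked at a vector of the carrier, all functionals being zero
  elsewhere.\<close>

lemma dual_map_linear:
  assumes "bilinear_on scale scale V V m" and x: "x \<in> V" and u: "u \<in> dual_space scale V"
  shows "dual_map V m x u \<in> dual_space scale V"
    and "y \<in> V \<Longrightarrow> dual_map V m (x + y) u = dual_map V m x u + dual_map V m y u"
    and "w \<in> dual_space scale V \<Longrightarrow> dual_map V m x (u + w) = dual_map V m x u + dual_map V m x w"
    and "dual_map V m (scale c x) u = fun_scale c (dual_map V m x u)"
    and "dual_map V m x (fun_scale c u) = fun_scale c (dual_map V m x u)"
  using x by (auto intro!: dual_spaceI
      simp: dual_map_def fun_scale_def fun_eq_iff dual_spaceD[OF u] dual_spaceD
        bilinear_on_simps[OF assms(1)] carrier_closed)

lemma transpose_map_in_dual_space: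
  assumes "linear_on scale scale V V f" "u \<in> dual_space scale V"
  shows "transpose_map V f u \<in> dual_space scale V"
  using assms(1) by (intro dual_spaceI)
    (auto simp: transpose_map_def linear_on_def dual_spaceD[OF assms(2)] carrier_closed)

end

section \<open>The double\<close>

text \<open>The two injections are linear, so they carry finite spanning sets of the factors to
  finite spanning sets of their images, and the sum of the images is the product.\<close>

lemma fin_dim_space_Times:
  assumes "fin_dim_space s1 V" "fin_dim_space s2 W"
  shows "fin_dim_space (module_prod.scale s1 s2) (V \<times> W)"
proof -
  interpret V: fin_dim_space s1 V by fact
  interpret W: fin_dim_space s2 W by fact
  interpret vector_space_prod s1 s2 by unfold_locales
  obtain B C where B: "finite B" "V.span B = V" and C: "finite C" "W.span C = W"
    using V.finite_spanning W.finite_spanning by blast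
  let ?S = "(\<lambda>x. (x, 0)) ` B \<union> Pair 0 ` C"
  interpret l: module_hom s1 scale "\<lambda>x. (x, 0)"
    by unfold_locales (auto simp: scale_prod)
  interpret r: module_hom s2 scale "Pair 0"
    by unfold_locales (auto simp: scale_prod)
  have "p.span ((\<lambda>x. (x, 0)) ` B) = (\<lambda>x. (x, 0)) ` V" "p.span (Pair 0 ` C) = Pair 0 ` W"
    using l.span_image[of B] r.span_image[of C] B C by simp_all
  then have "p.span ?S = {X + Y | X Y. X \<in> (\<lambda>x. (x, 0)) ` V \<and> Y \<in> Pair 0 ` W}"
    unfolding p.span_Un by (simp only:)
  also have "\<dots> = V \<times> W"
  proof (intro subset_antisym subsetI)
    fix Z assume "Z \<in> V \<times> W"
    then show "Z \<in> {X + Y | X Y. X \<in> (\<lambda>x. (x, 0)) ` V \<and> Y \<in> Pair 0 ` W}"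
      by (intro CollectI exI[of _ "(fst Z, 0)"] exI[of _ "(0, snd Z)"]) auto
  qed auto
  finally have "p.span ?S = V \<times> W" .
  then show ?thesis
    using B C subspace_Times[OF V.subspace_carrier W.subspace_carrier]
    by unfold_locales (auto intro!: exI[of _ ?S])
qed

section \<open>Bilinearity on the double and nondegeneracy of the pairing\<close>

context fin_dim_space
begin

lemma double_scale_Pair [simp]: "double_scale scale c (x, a) = (scale c x, fun_scale c a)"
proof -
  interpret F: vector_space "fun_scale :: 'k \<Rightarrow> ('v \<Rightarrow> 'k) \<Rightarrow> 'v \<Rightarrow> 'k"
    by (rule vector_space_fun_scale)
  interpret vector_space_prod scale "fun_scale :: 'k \<Rightarrow> ('v \<Rightarrow> 'k) \<Rightarrow> 'v \<Rightarrow> 'k"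
    by unfold_locales
  show ?thesis
    by (simp add: double_scale_def scale_prod)
qed

lemma fin_dim_double_space: "fin_dim_space (double_scale scale) (double_space scale V)"
  unfolding double_scale_def double_space_def
  by (intro fin_dim_space_Times fin_dim_dual_space fin_dim_space_axioms)

lemma double_mul_bilinear:
  assumes m: "bilinear_on scale scale V V m"
  shows "bilinear_on (double_scale scale) (double_scale scale)
    (double_space scale V) (double_space scale V) (double_mul V m)"
proof -
  interpret D: fin_dim_space fun_scale "dual_space scale V"
    by (rule fin_dim_dual_space)
  show ?thesis
    unfolding bilinear_on_def linear_on_def double_space_def double_mul_def
    by (auto simp: dual_map_linear[OF m] bilinear_on_simps[OF m] D.carrier_closed
        D.scale_right_diff_distrib)
qed

lemma double_bracket_bilinear:
  assumes m: "bilinear_on scale scale V V m"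
  shows "bilinear_on (double_scale scale) (double_scale scale)
    (double_space scale V) (double_space scale V) (double_bracket V m)"
proof -
  interpret D: fin_dim_space fun_scale "dual_space scale V"
    by (rule fin_dim_dual_space)
  show ?thesis
    unfolding bilinear_on_def linear_on_def double_space_def double_bracket_def
    by (auto simp: dual_map_linear[OF m] bilinear_on_simps[OF m] D.carrier_closed carrier_closed
        commutator_def scale_right_diff_distrib
        D.scale_right_diff_distrib)
qed

lemma double_map_linear:
  assumes "linear_on scale scale V V f" "linear_on scale scale V V g"
  shows "linear_on (double_scale scale) (double_scale scale)
    (double_space scale V) (double_space scale V) (double_map V f g)"
  using assms(1) transpose_map_in_dual_space[OF assms(2)]
  unfolding double_space_def double_map_def
  by (auto simp: linear_on_def)
    (auto simp: transpose_map_def fun_scale_def fun_eq_iff)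

lemma double_form_bilinear:
  "bilinear_on (double_scale scale) (*) (double_space scale V) UNIV double_form"
  unfolding bilinear_on_def linear_on_def double_space_def double_form_def
  by (auto simp: dual_spaceD fun_scale_def algebra_simps)

lemma double_form_symmetric: "symmetric_form (double_space scale V) double_form"
  unfolding symmetric_form_def double_form_def by (auto simp: add.commute)

text \<open>Pairing \<open>(x, a)\<close> with \<open>(v, 0)\<close> reads off \<open>a v\<close>,
  and pairing it with \<open>(0, u)\<close> reads off \<open>u x\<close>; functionals separate the
  vectors of the carrier.\<close>

lemma double_form_nondegenerate: "nondegenerate_form (double_space scale V) double_form"
  unfolding nondegenerate_form_def
proof (intro ballI impI)
  interpret D: fin_dim_space fun_scale "dual_space scale V"
    by (rule fin_dim_dual_space)
  fix X assume "X \<in> double_space scale V"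
    and orth: "\<forall>Y\<in>double_space scale V. double_form X Y = 0"
  then obtain x a where X: "X = (x, a)" "x \<in> V" and a: "a \<in> dual_space scale V"
    by (auto simp: double_space_def)
  \<comment> \<open>\<open>a\<close> has to vanish on the whole ambient type; outside the carrier
    this is the extension by zero.\<close>
  have "a v = 0" for v
  proof (cases "v \<in> V")
    case True
    then have "(v, 0) \<in> double_space scale V"
      by (simp add: double_space_def D.carrier_closed)
    with orth have "double_form X (v, 0) = 0" by blast
    then show ?thesis by (simp add: X double_form_def)
  qed (simp add: dual_spaceD[OF a])
  moreover have "u x = 0" if "u \<in> dual_space scale V" for u
  proof -
    have "(0, u) \<in> double_space scale V"
      using that by (simp add: double_space_def carrier_closed)
    with orth have "double_form X (0, u) = 0" by blast
    then show ?thesis by (simp add: X double_form_def dual_spaceD[OF a])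
  qed
  then have "x = 0"
    using dual_space_separates X by blast
  ultimately show "X = 0"
    by (auto simp: X zero_prod_def fun_eq_iff)
qed

end

section \<open>Associativity of the double and invariance of the pairing\<close>

context comm_assoc_algebra
begin

lemma double_comm_assoc_algebra:
  "comm_assoc_algebra (double_scale scale) (double_space scale V) (double_mul V mul)"
proof -
  interpret D: fin_dim_space "double_scale scale" "double_space scale V"
    by (rule fin_dim_double_space)
  note closed = bilinear_on_simps(1)[OF mul_bilinear]
  show ?thesis
  proof
    show "double_mul V mul X Y = double_mul V mul Y X"
      if "X \<in> double_space scale V" "Y \<in> double_space scale V" for X Y
      using that mul_commute by (auto simp: double_space_def double_mul_def)
    fix X Y Z
    assume "X \<in> double_space scale V" "Y \<in> double_space scale V" "Z \<in> double_space scale V"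
    then obtain x y z a b c where XYZ: "X = (x, a)" "Y = (y, b)" "Z = (z, c)"
      and xyz: "x \<in> V" "y \<in> V" "z \<in> V"
      by (auto simp: double_space_def)
    \<comment> \<open>When the two bracketings are evaluated at \<open>v\<close>, these equalities
      match the terms in \<open>c\<close>, \<open>a\<close> and \<open>b\<close>, in this
      order.\<close>
    have "(x \<cdot> y) \<cdot> v = y \<cdot> (x \<cdot> v)" "(y \<cdot> z) \<cdot> v = y \<cdot> (z \<cdot> v)" "x \<cdot> (z \<cdot> v) = z \<cdot> (x \<cdot> v)"
      if "v \<in> V" for v
      using that xyz by (metis mul_assoc mul_commute)+
    then show "double_mul V mul (double_mul V mul X Y) Z = double_mul V mul X (double_mul V mul Y Z)"
      using xyz by (auto simp: XYZ double_mul_def dual_map_def fun_eq_iff mul_assoc closed)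
  qed (rule double_mul_bilinear[OF mul_bilinear])
qed

text \<open>For \<open>(x, a)\<close>, \<open>(y, b)\<close>, \<open>(z, c)\<close> both sides
  expand to \<open>a (y \<cdot> z) + b (x \<cdot> z) + c (x \<cdot> y)\<close>, up to commuting
  factors.\<close>

lemma double_form_invariant:
  "invariant_form (double_space scale V) (double_mul V mul) double_form"
  unfolding invariant_form_def double_space_def double_form_def double_mul_def dual_map_def
  by (auto simp: mul_commute)

end

section \<open>Jacobi identity on the double and the cocycle condition\<close>

context anti_pre_lie_algebra
begin

text \<open>The double is a semidirect product: the sub-adjacent Lie algebra acts on the dual by
  precomposing functionals with left multiplication. The assumption supplies the Jacobi identity in
  the vector component.\<close>

lemma double_lie_algebra:
  assumes "lie_algebra scale V (commutator (\<circ>\<^sub>A))"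
  shows "lie_algebra (double_scale scale) (double_space scale V) (double_bracket V (\<circ>\<^sub>A))"
proof -
  interpret L: lie_algebra scale V "commutator (\<circ>\<^sub>A)" by fact
  interpret D: fin_dim_space "double_scale scale" "double_space scale V"
    by (rule fin_dim_double_space)
  note closed = bilinear_on_simps(1)[OF circ_bilinear] bilinear_on_simps(1)[OF L.br_bilinear]
  show ?thesis
  proof
    show "double_bracket V (\<circ>\<^sub>A) X X = 0" if "X \<in> double_space scale V" for X
      using that L.br_self by (auto simp: double_space_def double_bracket_def zero_prod_def)
    fix X Y Z
    assume "X \<in> double_space scale V" "Y \<in> double_space scale V" "Z \<in> double_space scale V"
    then obtain x y z a b c where XYZ: "X = (x, a)" "Y = (y, b)" "Z = (z, c)"
      and xyz: "x \<in> V" "y \<in> V" "z \<in> V"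
      and abc: "a \<in> dual_space scale V" "b \<in> dual_space scale V" "c \<in> dual_space scale V"
      by (auto simp: double_space_def)
    \<comment> \<open>This says that precomposition is a representation. It reverses the order of
      two left multiplications, which fits the reversed commutator in the anti-pre-Lie
      identity.\<close>
    have u_br: "u (commutator (\<circ>\<^sub>A) x y \<circ>\<^sub>A v) = u (y \<circ>\<^sub>A (x \<circ>\<^sub>A v)) - u (x \<circ>\<^sub>A (y \<circ>\<^sub>A v))"
      if "u \<in> dual_space scale V" "x \<in> V" "y \<in> V" "v \<in> V" for u x y v
      using that anti_pre_lie[of y x v] dual_spaceD(2)[OF that(1)] closed by metis
    show "double_bracket V (\<circ>\<^sub>A) X (double_bracket V (\<circ>\<^sub>A) Y Z)
      + double_bracket V (\<circ>\<^sub>A) Y (double_bracket V (\<circ>\<^sub>A) Z X)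
      + double_bracket V (\<circ>\<^sub>A) Z (double_bracket V (\<circ>\<^sub>A) X Y) = 0"
      using xyz L.jacobi[OF xyz]
      by (auto simp: XYZ double_bracket_def dual_map_def fun_eq_iff closed zero_prod_def
          u_br[OF abc(1)] u_br[OF abc(2)] u_br[OF abc(3)])
  qed (rule double_bracket_bilinear[OF circ_bilinear])
qed

text \<open>The terms of the cyclic sum in \<open>c\<close> are
  \<open>c (commutator (\<circ>\<^sub>A) x y)\<close>, \<open>c (y \<circ>\<^sub>A x)\<close> and
  \<open>- c (x \<circ>\<^sub>A y)\<close>, which cancel; those in \<open>a\<close> and
  \<open>b\<close> are cyclic shifts of them.\<close>

lemma double_form_cocycle:
  "commutative_2_cocycle (double_space scale V) (double_bracket V (\<circ>\<^sub>A)) double_form"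
  unfolding commutative_2_cocycle_def
  by (auto simp: double_form_symmetric)
    (auto simp: double_space_def double_form_def double_bracket_def dual_map_def commutator_def
      dual_spaceD bilinear_on_simps(1)[OF circ_bilinear])

end

section \<open>The relative Poisson structure on the double\<close>

context relative_PCA_algebra
begin

lemma double_relative_poisson_algebra:
  "relative_poisson_algebra (double_scale scale) (double_space scale V)
    (double_mul V mul) (double_bracket V (\<circ>\<^sub>A)) (double_map V P Q)"
proof -
  interpret M: comm_assoc_algebra "double_scale scale" "double_space scale V" "double_mul V mul"
    by (rule double_comm_assoc_algebra)
  interpret L: lie_algebra "double_scale scale" "double_space scale V" "double_bracket V (\<circ>\<^sub>A)"
    by (rule double_lie_algebra[OF lie_algebra_axioms])
  note closed = bilinear_on_simps(1)[OF mul_bilinear] bilinear_on_simps(1)[OF circ_bilinear]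
    bilinear_on_simps(1)[OF br_bilinear]
  have P_linear: "linear_on scale scale V V P"
    and P_mul: "\<And>x y. x \<in> V \<Longrightarrow> y \<in> V \<Longrightarrow> P (x \<cdot> y) = P x \<cdot> y + x \<cdot> P y"
    and P_br: "\<And>x y. x \<in> V \<Longrightarrow> y \<in> V \<Longrightarrow>
      P (commutator (\<circ>\<^sub>A) x y) = commutator (\<circ>\<^sub>A) (P x) y + commutator (\<circ>\<^sub>A) x (P y)"
    using derivation_mul derivation_br unfolding derivation_on_def by blast+
  have PQ: "P x \<in> V" "Q x \<in> V" if "x \<in> V" for x
    using that P_linear Q_linear unfolding linear_on_def by blast+
  \<comment> \<open>Transposing puts \<open>Q\<close> on the argument \<open>v\<close>. These rules
    move it past a left multiplication, at the cost of a term with \<open>P\<close>, which is the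
    derivation rule in the functional component.\<close>
  have u_Q_mul: "u (x \<cdot> Q v) = u (P x \<cdot> v) + u (Q (x \<cdot> v))"
    and u_Q_circ: "u (x \<circ>\<^sub>A Q v) = u (P x \<circ>\<^sub>A v) + u (Q (x \<circ>\<^sub>A v))"
    if u: "u \<in> dual_space scale V" and x: "x \<in> V" "v \<in> V" for u x v
  proof -
    have "x \<cdot> Q v = P x \<cdot> v + Q (x \<cdot> v)" "x \<circ>\<^sub>A Q v = P x \<circ>\<^sub>A v + Q (x \<circ>\<^sub>A v)"
      using Q_mul[OF x] Q_circ[OF x] by (simp_all add: algebra_simps)
    then show "u (x \<cdot> Q v) = u (P x \<cdot> v) + u (Q (x \<cdot> v))"
      "u (x \<circ>\<^sub>A Q v) = u (P x \<circ>\<^sub>A v) + u (Q (x \<circ>\<^sub>A v))"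
      using x by (simp_all add: dual_spaceD[OF u] closed PQ)
  qed
  have u_mul_circ: "u (x \<cdot> (z \<circ>\<^sub>A v)) =
      u (z \<circ>\<^sub>A (x \<cdot> v)) + u (commutator (\<circ>\<^sub>A) z x \<cdot> v) + u (x \<cdot> (P z \<cdot> v))"
    if u: "u \<in> dual_space scale V" and x: "x \<in> V" "z \<in> V" "v \<in> V" for u x z v
  proof -
    \<comment> \<open>Written as \<open>0 - ...\<close>, the negation falls under the rule for
      differences; its instance at two zeros supplies \<open>0 \<cdot> v = 0\<close>.\<close>
    have "commutator (\<circ>\<^sub>A) z x = 0 - commutator (\<circ>\<^sub>A) x z"
      by (simp add: commutator_def)
    then have "commutator (\<circ>\<^sub>A) z x \<cdot> v = 0 - commutator (\<circ>\<^sub>A) x z \<cdot> v"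
      using x bilinear_on_simps(4)[OF mul_bilinear, of 0 "commutator (\<circ>\<^sub>A) x z" v]
        bilinear_on_simps(4)[OF mul_bilinear, of 0 0 v] by (simp add: closed carrier_closed)
    then have "x \<cdot> (z \<circ>\<^sub>A v) = z \<circ>\<^sub>A (x \<cdot> v) + commutator (\<circ>\<^sub>A) z x \<cdot> v + x \<cdot> (P z \<cdot> v)"
      using mul_circ[OF x] x by (simp add: algebra_simps mul_assoc PQ)
    then show ?thesis
      using x by (simp add: dual_spaceD[OF u] closed PQ carrier_closed)
  qed
  \<comment> \<open>This treats the functional of the element outside the product in the relative
    Leibniz rule; the term with \<open>Q\<close> answers to the transpose acting on that
    functional.\<close>
  have u_circ_mul: "u ((x \<cdot> y) \<circ>\<^sub>A v) =
      u (y \<circ>\<^sub>A (x \<cdot> v)) + u (x \<circ>\<^sub>A (y \<cdot> v)) - u (Q (x \<cdot> y \<cdot> v))"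
    if u: "u \<in> dual_space scale V" and x: "x \<in> V" "y \<in> V" "v \<in> V" for u x y v
  proof -
    have "(x \<cdot> y) \<circ>\<^sub>A v = y \<circ>\<^sub>A (x \<cdot> v) + x \<circ>\<^sub>A (y \<cdot> v) - Q (x \<cdot> y \<cdot> v)"
      using circ_mul[OF x] by (simp add: algebra_simps)
    then show ?thesis
      using x by (simp add: dual_spaceD[OF u] closed PQ carrier_closed)
  qed
  show ?thesis
  proof
    show "derivation_on (double_scale scale) (double_space scale V)
        (double_mul V mul) (double_map V P Q)"
      unfolding derivation_on_def
    proof (intro conjI ballI double_map_linear P_linear Q_linear)
      fix X Y assume "X \<in> double_space scale V" "Y \<in> double_space scale V"
      then show "double_map V P Q (double_mul V mul X Y) =
          double_mul V mul (double_map V P Q X) Y + double_mul V mul X (double_map V P Q Y)"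
        by (auto simp: double_space_def double_map_def double_mul_def dual_map_def
            transpose_map_def fun_eq_iff closed PQ P_mul u_Q_mul)
    qed
    show "derivation_on (double_scale scale) (double_space scale V)
        (double_bracket V (\<circ>\<^sub>A)) (double_map V P Q)"
      unfolding derivation_on_def
    proof (intro conjI ballI double_map_linear P_linear Q_linear)
      fix X Y assume "X \<in> double_space scale V" "Y \<in> double_space scale V"
      then show "double_map V P Q (double_bracket V (\<circ>\<^sub>A) X Y) =
          double_bracket V (\<circ>\<^sub>A) (double_map V P Q X) Y
          + double_bracket V (\<circ>\<^sub>A) X (double_map V P Q Y)"
        by (auto simp: double_space_def double_map_def double_bracket_def dual_map_def
            transpose_map_def fun_eq_iff closed PQ P_br u_Q_circ)
    qed
    fix X Y Z
    assume "X \<in> double_space scale V" "Y \<in> double_space scale V" "Z \<in> double_space scale V"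
    then obtain x y z a b c where XYZ: "X = (x, a)" "Y = (y, b)" "Z = (z, c)"
      and xyz: "x \<in> V" "y \<in> V" "z \<in> V"
      and abc: "a \<in> dual_space scale V" "b \<in> dual_space scale V" "c \<in> dual_space scale V"
      by (auto simp: double_space_def)
    \<comment> \<open>The left side evaluated at \<open>v\<close> is \<open>b (x \<cdot> (z
      \<circ>\<^sub>A v)) + a (y \<cdot> (z \<circ>\<^sub>A v)) - c ((x \<cdot> y) \<circ>\<^sub>A
      v)\<close>. The first two terms are expanded by \<open>u_mul_circ\<close>, the last by
      \<open>u_circ_mul\<close>.\<close>
    show "double_bracket V (\<circ>\<^sub>A) Z (double_mul V mul X Y) =
        double_mul V mul (double_bracket V (\<circ>\<^sub>A) Z X) Y
        + double_mul V mul X (double_bracket V (\<circ>\<^sub>A) Z Y)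
        + double_mul V mul (double_mul V mul X Y) (double_map V P Q Z)"
      using xyz
      by (auto simp: XYZ double_map_def double_mul_def double_bracket_def dual_map_def
          transpose_map_def fun_eq_iff closed PQ relative_leibniz
          u_mul_circ[OF abc(1)] u_mul_circ[OF abc(2)] u_circ_mul[OF abc(3)])
  qed
qed

end

theorem proposition2p17:
  fixes scale :: "'k::{alg_closed_field,field_char_0} \<Rightarrow> 'v::ab_group_add \<Rightarrow> 'v"
    and A :: "'v set"
    and mul circ :: "'v \<Rightarrow> 'v \<Rightarrow> 'v"
    and P Q :: "'v \<Rightarrow> 'v"
  assumes "relative_PCA_algebra scale A mul circ P Q"
  shows "invariant_c2c_form (double_scale scale) (double_space scale A)
           (double_mul A mul) (double_bracket A circ) (double_map A P Q) double_form"
proof -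
  interpret relative_PCA_algebra scale A mul circ P Q by fact
  show ?thesis
    by (intro invariant_c2c_form.intro invariant_c2c_form_axioms.intro
        double_relative_poisson_algebra double_form_bilinear double_form_symmetric
        double_form_nondegenerate double_form_invariant double_form_cocycle)
qed

end
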